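(* If $q = cn$ for some constant $c > 0$, then $\mathcal{L}(n,q) = \Omega(\ln n)$. That is, for every constant $c>0$ there exist a constant $c'>0$ and an integer $n_0$ such that $\mathcal{L}(n,q) \geq c' \ln n$ for all positive integers $n \geq n_0$ and $q$ with $q = cn$.
   Context: The $(q:1)$ Waiter-Client game on $E(K_n)$ (for a positive integer $q$) is the following two-player perfect information game. In each round, Waiter offers Client exactly $q+1$ edges of the complete graph $K_n$ which have not been claimed before; Client chooses one of these edges, which he keeps, and the remaining $q$ edges are claimed by Waiter. If fewer than $q+1$ unclaimed edges remain, all of them are claimed by Waiter. The game ends when all edges of $K_n$ have been claimed. Client's graph is the graph with vertex set $V(K_n)$ whose edges are all the edges claimed by Client. $\mathcal{L}(n,q)$ denotes the order (number of vertices) of a largest connected component of Client's graph at the end of the $(q:1)$ Waiter-Client game on $E(K_n)$ when Client tries to minimize this quantity, Waiter tries to maximize it, and both follow optimal strategies. *)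

theory Defs
  imports Complex_Main
begin

text \<open>Edges of a simple graph are two-element sets of vertices.\<close>

definition complete_edges :: "'a set \<Rightarrow> 'a set set" where
  "complete_edges V = {e. e \<subseteq> V \<and> card e = 2}"

definition connectedness :: "'a set \<Rightarrow> 'a set set \<Rightarrow> ('a \<times> 'a) set" where
  "connectedness V E = {(u, v). {u, v} \<in> E}\<^sup>* \<inter> V \<times> V"

text \<open>The vertex sets of the connected components of the graph with vertex set V and edge set E;
  isolated vertices form components of order 1.\<close>

definition components :: "'a set \<Rightarrow> 'a set set \<Rightarrow> 'a set set" where
  "components V E = V // connectedness V E"

definition largest_component_order :: "'a set \<Rightarrow> 'a set set \<Rightarrow> nat" where
  "largest_component_order V E = Max (card ` components V E)"

text \<open>The value, under optimal play, of the position of the (q:1) Waiter-Client game on vertex set V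
  in which Client owns the edges C and the edges F are unclaimed; all other edges belong to Waiter.
  Waiter (maximizing) offers q + 1 edges of F, Client (minimizing) keeps one of them, and
  Waiter claims the rest of the offer. Once at most q edges are unclaimed, Waiter claims all
  of them, so Client's graph is final. As \<^term>\<open>card F = 0\<close> for infinite F, the recursive case
  only concerns finite F, and there both extrema range over finite nonempty sets.\<close>

function position_value :: "nat \<Rightarrow> 'a set \<Rightarrow> 'a set set \<Rightarrow> 'a set set \<Rightarrow> nat" where
  "position_value q V C F =
    (if card F < q + 1 then largest_component_order V C
     else Max ((\<lambda>A. Min ((\<lambda>e. position_value q V (insert e C) (F - A)) ` A))
                 ` {A. A \<subseteq> F \<and> card A = q + 1}))"
  by pat_completeness auto
termination
proof (relation "Wellfounded.measure (\<lambda>(q, V, C, F). card F)")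
  fix q :: nat and V :: "'a set" and C F A :: "'a set set" and e
  assume "\<not> card F < q + 1" and A: "A \<in> {A. A \<subseteq> F \<and> card A = q + 1}"
  then have "card F > 0" by linarith
  then have "finite F" by (simp add: card_gt_0_iff)
  moreover have "A \<noteq> {}" using A by auto
  ultimately have "card (F - A) < card F"
    using A by (intro psubset_card_mono) auto
  then show "((q, V, insert e C, F - A), (q, V, C, F))
      \<in> Wellfounded.measure (\<lambda>(q, V, C, F). card F)"
    by simp
qed simp

declare position_value.simps [simp del]

text \<open>The quantity \<open>\<L>(n, q)\<close>, with vertex set \<open>{0, ..., n - 1}\<close>; meaningful for positive n and q.\<close>

definition waiter_client_L :: "nat \<Rightarrow> nat \<Rightarrow> nat" where
  "waiter_client_L n q = position_value q {..<n} {} (complete_edges {..<n})"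

end

theory Submission
  imports Defs
begin

text \<open>Waiter grows trees in Client's graph, remembering for each tree an active endpoint whose
  level is a lower bound for the number of edges of the tree. All edges that join a fresh vertex
  to a fresh or active vertex stay unclaimed. Let \<open>M\<close> be a constant slightly above \<open>2c\<close>. As long
  as there are at least \<open>n/2\<close> fresh vertices, \<open>M\<close> active vertices of a common level \<open>j\<close> send more
  than \<open>q\<close> free edges to them. Waiter offers these, gives up the \<open>M\<close> active vertices,
  and the fresh endpoint of Client's edge becomes active at level \<open>j + 1\<close>. If level \<open>j\<close> has weight
  \<open>M ^ j\<close>, the total weight of the active vertices is preserved. With \<open>M ^ k\<close> initial
  active vertices the process can therefore only stop once level \<open>k\<close> is reached, and
  \<open>M ^ k \<le> n/4\<close> permits \<open>k\<close> of order \<open>ln n\<close>.\<close>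

section \<open>Lower bounds for the values of positions\<close>

lemma largest_component_order_ge:
  assumes "finite V" and "x \<in> V" and "T \<subseteq> V"
    and "\<And>y. y \<in> T \<Longrightarrow> (x, y) \<in> {(u, v). {u, v} \<in> C}\<^sup>*"
  shows "card T \<le> largest_component_order V C"
proof -
  let ?K = "connectedness V C `` {x}"
  have sub: "?K \<subseteq> V" by (auto simp: connectedness_def)
  have "T \<subseteq> ?K" using assms by (auto simp: connectedness_def)
  then have "card T \<le> card ?K"
    using sub \<open>finite V\<close> by (meson card_mono finite_subset)
  moreover have "?K \<in> components V C"
    unfolding components_def using \<open>x \<in> V\<close> by (rule quotientI)
  moreover have "finite (components V C)"
    unfolding components_def quotient_def using \<open>finite V\<close> by simp
  ultimately show ?thesis
    unfolding largest_component_order_def by (meson Max_ge finite_imageI imageI le_trans)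
qed

text \<open>Waiter maximizes, so exhibiting a single good offer suffices, provided that every reply
  of Client is covered. Waiter's strategies below are verified one offer at a time in this
  way.\<close>

lemma position_value_ge_offer:
  assumes "finite F" and A: "A \<subseteq> F" "card A = q + 1"
    and ge: "\<And>e. e \<in> A \<Longrightarrow> s \<le> position_value q V (insert e C) (F - A)"
  shows "s \<le> position_value q V C F"
proof -
  let ?g = "\<lambda>A. Min ((\<lambda>e. position_value q V (insert e C) (F - A)) ` A)"
  let ?O = "{A. A \<subseteq> F \<and> card A = q + 1}"
  have "finite A" "A \<noteq> {}" using A by (auto intro: card_ge_0_finite)
  then have "s \<le> ?g A" using ge by simp
  also have "\<dots> \<le> Max (?g ` ?O)"
    using A \<open>finite F\<close> by (intro Max_ge) auto
  also have "\<dots> = position_value q V C F"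
    using card_mono[OF \<open>finite F\<close> A(1)] A(2) by (subst (2) position_value.simps) simp
  finally show ?thesis .
qed

text \<open>Client's edges are never removed, so connections once made persist. Waiter may play
  arbitrarily from here on, and any offer serves in the induction.\<close>

lemma position_value_ge_connected:
  assumes "finite V" and "finite F" and "x \<in> V" and "T \<subseteq> V"
    and "\<And>y. y \<in> T \<Longrightarrow> (x, y) \<in> {(u, v). {u, v} \<in> C}\<^sup>*"
  shows "card T \<le> position_value q V C F"
  using assms(2,5)
proof (induction "card F" arbitrary: C F rule: less_induct)
  case less
  show ?case
  proof (cases "card F < q + 1")
    case True
    then show ?thesis
      using largest_component_order_ge[OF assms(1,3,4) less.prems(2)]
      by (simp add: position_value.simps)
  next
    case False
    then obtain A where A: "A \<subseteq> F" "card A = q + 1"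
      by (meson not_less obtain_subset_with_card_n)
    have "A \<noteq> {}" using A(2) by auto
    then have "card (F - A) < card F"
      using A(1) less.prems(1) by (intro psubset_card_mono) auto
    moreover have "{(u, v). {u, v} \<in> C}\<^sup>* \<subseteq> {(u, v). {u, v} \<in> insert e C}\<^sup>*" for e
      by (intro rtrancl_mono) auto
    ultimately show ?thesis
      using less.prems
      by (intro position_value_ge_offer[OF less.prems(1) A] less.hyps) auto
  qed
qed

section \<open>The tree-growing strategy\<close>

lemma card_edges_between:
  assumes "Q \<inter> R = {}"
  shows "card ((\<lambda>(x, w). {x, w}) ` (Q \<times> R)) = card Q * card R"
proof -
  have "inj_on (\<lambda>(x, w). {x, w}) (Q \<times> R)"
    using assms by (auto simp: inj_on_def doubleton_eq_iff)
  then show ?thesis by (simp add: card_image card_cartesian_product)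
qed

text \<open>Pigeonhole in base \<open>M\<close>: with at most \<open>M - 1\<close> elements on each
  level below \<open>k\<close>, the total weight would be at most
  \<open>(M - 1) * (1 + M + ... + M ^ (k - 1)) = M ^ k - 1\<close>.\<close>

lemma popular_level:
  fixes lev :: "'a \<Rightarrow> nat"
  assumes "finite P" and weight: "M ^ k \<le> (\<Sum>x\<in>P. M ^ lev x)" and "M > 0"
    and low: "\<And>x. x \<in> P \<Longrightarrow> lev x < k"
  shows "\<exists>j. M \<le> card {x \<in> P. lev x = j}"
proof (rule ccontr)
  assume "\<not> ?thesis"
  then have few: "card {x \<in> P. lev x = j} \<le> M - 1" for j
    by (metis Suc_pred' \<open>M > 0\<close> less_Suc_eq_le not_less)
  have "(\<Sum>x\<in>P. M ^ lev x) = (\<Sum>j<k. \<Sum>x\<in>{x \<in> P. lev x = j}. M ^ lev x)"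
    using \<open>finite P\<close> low by (intro sum.group[symmetric]) auto
  also have "\<dots> = (\<Sum>j<k. card {x \<in> P. lev x = j} * M ^ j)"
    by (intro sum.cong) auto
  also have "\<dots> \<le> (\<Sum>j<k. (M - 1) * M ^ j)"
    using few by (intro sum_mono mult_right_mono) auto
  also have "\<dots> < M ^ k"
  proof (induction k)
    case (Suc k)
    then show ?case using \<open>M > 0\<close> by (cases M) auto
  qed simp
  finally show False using weight by simp
qed

text \<open>\<open>P\<close> and \<open>R\<close> are the sets of active and fresh vertices. A move turns one fresh vertex into
  an active one and decreases \<open>card P\<close>, so \<open>r\<close> fresh vertices remain throughout.\<close>

lemma position_value_ge_level:
  assumes "finite V" and "M \<ge> 2" and many: "q + 1 \<le> M * r"
    and "finite F" and "P \<subseteq> V" and "R \<subseteq> V" and "P \<inter> R = {}"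
    and "r + card P \<le> card R"
    and "\<And>x w. x \<in> P \<union> R \<Longrightarrow> w \<in> R \<Longrightarrow> x \<noteq> w \<Longrightarrow> {x, w} \<in> F"
    and "\<And>x. x \<in> P \<Longrightarrow> \<exists>T \<subseteq> V - R. lev x < card T \<and>
           (\<forall>y\<in>T. (x, y) \<in> {(u, v). {u, v} \<in> C}\<^sup>*)"
    and "M ^ k \<le> (\<Sum>x\<in>P. M ^ lev x)"
  shows "k < position_value q V C F"
  using assms(4-)
proof (induction "card P" arbitrary: P R F C lev rule: less_induct)
  case less
  note finF = less.prems(1) and PV = less.prems(2) and RV = less.prems(3)
    and disj = less.prems(4) and cardR = less.prems(5) and free = less.prems(6)
    and tree = less.prems(7) and weight = less.prems(8)
  have finP: "finite P" and finR: "finite R"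
    using PV RV \<open>finite V\<close> finite_subset by auto
  show ?case
  proof (cases "\<exists>x\<in>P. k \<le> lev x")
    case True
    then obtain x where x: "x \<in> P" "k \<le> lev x" by blast
    from tree[OF x(1)] obtain T where T: "T \<subseteq> V - R" "lev x < card T"
      "\<And>y. y \<in> T \<Longrightarrow> (x, y) \<in> {(u, v). {u, v} \<in> C}\<^sup>*" by blast
    have "card T \<le> position_value q V C F"
      using \<open>finite V\<close> finF x(1) PV T by (intro position_value_ge_connected[of V F x]) auto
    then show ?thesis using T(2) x(2) by linarith
  next
    case False
    then obtain j where "M \<le> card {x \<in> P. lev x = j}"
      using popular_level[OF finP weight] \<open>M \<ge> 2\<close> by (meson le_trans not_less pos2)
    then obtain Q where Q: "Q \<subseteq> P" "card Q = M" and levQ: "\<And>x. x \<in> Q \<Longrightarrow> lev x = j"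
      by (smt (verit) mem_Collect_eq obtain_subset_with_card_n subset_eq)
    have finQ: "finite Q" using Q finP finite_subset by blast
    let ?B = "(\<lambda>(x, w). {x, w}) ` (Q \<times> R)"
    have QR: "Q \<inter> R = {}" using Q(1) disj by blast
    have "q + 1 \<le> M * card R"
      using many cardR by (meson add_leD1 le_trans mult_le_mono2)
    then have "q + 1 \<le> card ?B"
      unfolding card_edges_between[OF QR] Q(2) .
    then obtain A where A: "A \<subseteq> ?B" "card A = q + 1"
      by (meson obtain_subset_with_card_n)
    have "{x, w} \<in> F" if "x \<in> Q" "w \<in> R" for x w
      using that Q(1) QR by (intro free) auto
    then have "?B \<subseteq> F" by auto
    then have "A \<subseteq> F" using A by blast
    show ?thesis
      unfolding Suc_le_eq[symmetric]
    proof (rule position_value_ge_offer[OF finF \<open>A \<subseteq> F\<close> A(2)])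
      fix e
      assume "e \<in> A"
      then obtain x w where e: "e = {x, w}" and x: "x \<in> Q" and w: "w \<in> R"
        using A by auto
      let ?P = "insert w (P - Q)" and ?R = "R - {w}" and ?lev = "lev(w := Suc j)"
      have wP: "w \<notin> P" using w disj by auto
      have MP: "M \<le> card P" using Q finP card_mono by blast
      have cardP: "card ?P = card P - M + 1"
        using wP finP Q finQ by (simp add: card_Diff_subset)
      have "k < position_value q V (insert e C) (F - A)"
      proof (rule less.hyps)
        show "card ?P < card P" using cardP MP \<open>M \<ge> 2\<close> by simp
        show "finite (F - A)" using finF by simp
        show "?P \<subseteq> V" "?R \<subseteq> V" "?P \<inter> ?R = {}" using PV RV disj w by auto
        \<comment> \<open>The loss of \<open>w\<close> from \<open>R\<close> is compensated, since
          \<open>card P\<close> drops by \<open>M - 1 \<ge> 1\<close>.\<close>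
        show "r + card ?P \<le> card ?R"
          using cardP MP \<open>M \<ge> 2\<close> cardR w finR by (simp add: card_Diff_singleton)
        show "{y, v} \<in> F - A" if "y \<in> ?P \<union> ?R" "v \<in> ?R" "y \<noteq> v" for y v
        proof -
          \<comment> \<open>Every offered edge has an endpoint in \<open>Q\<close>, and all of
            \<open>Q\<close> is given up, so no edge needed later is lost.\<close>
          have "{y, v} \<inter> Q = {}" using that Q(1) disj w by auto
          then have "{y, v} \<notin> ?B" by auto
          moreover have "{y, v} \<in> F" using that w by (intro free) auto
          ultimately show ?thesis using A(1) by blast
        qed
        show "\<exists>T \<subseteq> V - ?R. ?lev y < card T \<and>
            (\<forall>z\<in>T. (y, z) \<in> {(u, v). {u, v} \<in> insert e C}\<^sup>*)" if y: "y \<in> ?P" for y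
        proof -
          have mono: "{(u, v). {u, v} \<in> C}\<^sup>* \<subseteq> {(u, v). {u, v} \<in> insert e C}\<^sup>*"
            by (intro rtrancl_mono) auto
          show ?thesis
          proof (cases "y = w")
            case True
            \<comment> \<open>The tree of \<open>w\<close> is that of the abandoned vertex
              \<open>x\<close> extended by \<open>w\<close>. Trees avoid fresh vertices, so
              \<open>w\<close> is new to it and the order grows by one.\<close>
            have "x \<in> P" using x Q(1) by blast
            from tree[OF this] obtain T where T: "T \<subseteq> V - R" "j < card T"
              "\<And>z. z \<in> T \<Longrightarrow> (x, z) \<in> {(u, v). {u, v} \<in> C}\<^sup>*"
              using levQ[OF x] by auto
            have "finite T" using T(1) \<open>finite V\<close> by (meson finite_Diff finite_subset)
            moreover have "w \<notin> T" using T(1) w by auto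
            ultimately have "Suc j < card (insert w T)" using T(2) by simp
            moreover have "(w, z) \<in> {(u, v). {u, v} \<in> insert e C}\<^sup>*" if "z \<in> insert w T" for z
            proof (cases "z = w")
              case False
              then have "(x, z) \<in> {(u, v). {u, v} \<in> insert e C}\<^sup>*"
                using T(3) mono that by blast
              moreover have "(w, x) \<in> {(u, v). {u, v} \<in> insert e C}"
                using e by (simp add: insert_commute)
              ultimately show ?thesis by (rule converse_rtrancl_into_rtrancl[rotated])
            qed simp
            moreover have "insert w T \<subseteq> V - ?R" using T(1) w RV by auto
            ultimately show ?thesis
              unfolding True by (intro exI[of _ "insert w T"] conjI ballI) simp_all
          next
            case False
            then have "y \<in> P" using y by auto
            from tree[OF this] obtain T where T: "T \<subseteq> V - R" "lev y < card T"
              "\<And>z. z \<in> T \<Longrightarrow> (y, z) \<in> {(u, v). {u, v} \<in> C}\<^sup>*" by blast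
            have "T \<subseteq> V - ?R" using T(1) by auto
            moreover have "?lev y < card T" using T(2) False by simp
            moreover have "\<forall>z\<in>T. (y, z) \<in> {(u, v). {u, v} \<in> insert e C}\<^sup>*"
              using T(3) mono by blast
            ultimately show ?thesis by blast
          qed
        qed
        \<comment> \<open>The \<open>M\<close> vertices of \<open>Q\<close> weigh
          \<open>M * M ^ j\<close> together, exactly the weight of \<open>w\<close> on level
          \<open>j + 1\<close>.\<close>
        have "(\<Sum>y\<in>P. M ^ lev y) = (\<Sum>y\<in>P - Q. M ^ lev y) + (\<Sum>y\<in>Q. M ^ lev y)"
          using Q(1) finP by (rule sum.subset_diff)
        also have "(\<Sum>y\<in>Q. M ^ lev y) = M ^ Suc j"
          using levQ Q(2) by simp
        also have "(\<Sum>y\<in>P - Q. M ^ lev y) = (\<Sum>y\<in>P - Q. M ^ ?lev y)"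
          using wP by (intro sum.cong) auto
        finally show "M ^ k \<le> (\<Sum>y\<in>?P. M ^ ?lev y)"
          using weight wP finP by simp
      qed
      then show "Suc k \<le> position_value q V (insert e C) (F - A)" by simp
    qed
  qed
qed

section \<open>Initial position and choice of parameters\<close>

lemma waiter_client_L_gt:
  assumes "M \<ge> 2" and "2 * M ^ k \<le> n" and "q + 1 \<le> M * (n - 2 * M ^ k)"
  shows "k < waiter_client_L n q"
  unfolding waiter_client_L_def
\<comment> \<open>The active vertices start as one-vertex trees of weight 1. Here
  \<open>r = n - 2 * M ^ k\<close>, the surplus of fresh over active vertices.\<close>
proof (rule position_value_ge_level[where P = "{..<M ^ k}" and R = "{M ^ k..<n}"
      and lev = "\<lambda>_. 0", OF _ assms(1,3)])
  show "finite (complete_edges {..<n})"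
    unfolding complete_edges_def by (rule finite_subset[of _ "Pow {..<n}"]) auto
  show "{x, w} \<in> complete_edges {..<n}"
    if "x \<in> {..<M ^ k} \<union> {M ^ k..<n}" "w \<in> {M ^ k..<n}" "x \<noteq> w" for x w
    using that assms(2) by (auto simp: complete_edges_def)
  show "\<exists>T \<subseteq> {..<n} - {M ^ k..<n}. 0 < card T \<and>
      (\<forall>y\<in>T. (x, y) \<in> {(u, v). {u, v} \<in> {}}\<^sup>*)" if "x \<in> {..<M ^ k}" for x
    using that assms(2) by (intro exI[of _ "{x}"]) auto
qed (use assms(2) in auto)

theorem proposition1p2:
  fixes c :: real
  assumes "c > 0"
  shows "\<exists>c'::real. c' > 0 \<and> (\<exists>n0::nat. \<forall>n q::nat. n > 0 \<longrightarrow> q > 0 \<longrightarrow> n \<ge> n0 \<longrightarrow>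
           real q = c * real n \<longrightarrow> real (waiter_client_L n q) \<ge> c' * ln (real n))"
proof -
  \<comment> \<open>With \<open>n / 2\<close> fresh vertices, \<open>M\<close> active ones send at
    least \<open>(c + 1) * n = q + n\<close> edges to them; the summand 2 thus pays for the
    \<open>+ 1\<close> in \<open>q + 1\<close> and also ensures \<open>M \<ge> 2\<close>.\<close>
  define M where "M = nat \<lceil>2 * c\<rceil> + 2"
  have M2: "M \<ge> 2" and Mc: "2 * c + 2 \<le> real M"
    unfolding M_def by (simp, linarith)
  then have lnM: "ln (real M) > 0" by simp
  have bound: "1 / (2 * ln (real M)) * ln (real n) \<le> real (waiter_client_L n q)"
    if n: "n \<ge> 16" and q: "real q = c * real n" for n q :: nat
  proof -
    have "1 \<le> n div 4" using n by simp
    then obtain k where k: "M ^ k \<le> n div 4" "n div 4 < M ^ (k + 1)"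
      using ex_power_ivl1[OF M2] by blast
    have Mk: "4 * M ^ k \<le> n" using k(1) by linarith
    have "n \<le> 2 * (n - 2 * M ^ k)" using Mk by linarith
    then have half: "real n / 2 \<le> real (n - 2 * M ^ k)" by linarith
    have "real (q + 1) \<le> (2 * c + 2) * (real n / 2)"
      using q n by (simp add: algebra_simps)
    also have "\<dots> \<le> real M * real (n - 2 * M ^ k)"
      using half Mc by (intro mult_mono) auto
    finally have "q + 1 \<le> M * (n - 2 * M ^ k)"
      by (simp flip: of_nat_mult del: of_nat_Suc)
    then have "k < waiter_client_L n q"
      using M2 Mk by (intro waiter_client_L_gt) auto
    moreover have "ln (real n) \<le> 2 * ln (real M) * real (k + 1)"
    proof -
      have "n < 4 * M ^ (k + 1)" using k(2) by linarith
      then have less: "real n < 4 * real M ^ (k + 1)"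
        by (metis of_nat_less_iff of_nat_mult of_nat_numeral of_nat_power)
      \<comment> \<open>Squaring absorbs the factor 4 in \<open>n < 4 * M ^ (k + 1)\<close>. This is
        where 16 comes from, and it costs the factor 2 in the constant
        \<open>1 / (2 * ln M)\<close>.\<close>
      have "16 * real n \<le> real n * real n" using n by (intro mult_right_mono) auto
      then have "real n \<le> (real n / 4)\<^sup>2" by (simp add: power2_eq_square)
      also have "(real n / 4)\<^sup>2 \<le> (real M ^ (k + 1))\<^sup>2" using less by (intro power_mono) auto
      finally have "ln (real n) \<le> ln ((real M ^ (k + 1))\<^sup>2)" using n M2 by simp
      also have "\<dots> = 2 * (real (k + 1) * ln (real M))"
        using M2 by (simp add: ln_realpow del: power_Suc)
      finally show ?thesis by (simp add: algebra_simps)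
    qed
    then have "1 / (2 * ln (real M)) * ln (real n) \<le> real (k + 1)"
      using lnM by (simp add: field_simps)
    ultimately show ?thesis by linarith
  qed
  then show ?thesis
    using lnM by (intro exI[of _ "1 / (2 * ln (real M))"] conjI exI[of _ 16]) auto
qed

end
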